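(* Let $\alpha$ be a nonzero complex number and $\lambda$ a complex number. For all integers $n\ge 0$ and $k\ge 1$, $$y_{1,\alpha}^{*}(n+1,k;\lambda)=\frac{\lambda}{k}\sum_{j=0}^{n}\binom{n}{j}\Big(y_{1,\alpha}^{*}(j,k-1;\lambda)+y_{1,\alpha}^{*}(j+1,k-1;\lambda)\Big)+\left(\frac{1+\alpha-k\alpha}{k}\right)y_{1,\alpha}^{*}(n+1,k-1;\lambda),$$ and for all integers $n\ge 0$, $y_{1,\alpha}^{*}(n,0;\lambda)=\delta_{n,0}$.
   Context: For an element $x$ of a commutative $\mathbb{C}$-algebra (e.g. a number or a formal power series in $t$), the degenerate falling factorial is $(x)_{0,\alpha}=1$ and $(x)_{n,\alpha}=x(x-\alpha)(x-2\alpha)\cdots(x-(n-1)\alpha)$ for $n\ge 1$. The new type degenerate Simsek numbers $y_{1,\alpha}^{*}(n,k;\lambda)$ are defined by the generating function $$\frac{(\lambda e^t+1)_{k,\alpha}}{k!}=\sum_{n=0}^{\infty}y_{1,\alpha}^{*}(n,k;\lambda)\frac{t^n}{n!}.$$ Here $\delta_{n,0}$ is the Kronecker delta. *)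

theory Defs
  imports Complex_Main "HOL-Computational_Algebra.Formal_Power_Series"
begin

text \<open>
  The argument \<open>a\<close> is the image of the scalar \<open>\<alpha>\<close> in the algebra
  (for formal power series, \<open>fps_const \<alpha>\<close>).
\<close>
definition deg_falling_fact :: "'a::comm_ring_1 \<Rightarrow> 'a \<Rightarrow> nat \<Rightarrow> 'a" where
  "deg_falling_fact a x n = (\<Prod>i<n. x - of_nat i * a)"

definition simsek_gf :: "complex \<Rightarrow> nat \<Rightarrow> complex \<Rightarrow> complex fps" where
  "simsek_gf \<alpha> k lam =
     fps_const (1 / fact k) *
       deg_falling_fact (fps_const \<alpha>) (fps_const lam * fps_exp 1 + 1) k"

definition simsek :: "complex \<Rightarrow> nat \<Rightarrow> nat \<Rightarrow> complex \<Rightarrow> complex" where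
  "simsek \<alpha> n k lam = fact n * fps_nth (simsek_gf \<alpha> k lam) n"

lemma simsek_gf_eq: "simsek_gf \<alpha> k lam = Abs_fps (\<lambda>n. simsek \<alpha> n k lam / fact n)"
  by (simp add: simsek_def fps_eq_iff)

end

(* Passing from k - 1 to k multiplies the generating function by
   (lam * exp t + 1 - (k - 1) * alpha) / k. Differentiating this relation and comparing
   coefficients gives the recurrence, since multiplication by exp t is a binomial convolution. *)
theory Submission
  imports Defs
begin

text \<open>The reason is \<open>fact n / fact (n - j) = of_nat (n choose j) * fact j\<close>. The
  factor \<open>fact j\<close> stays with the coefficient of \<open>F\<close>, which makes it an
  exponential coefficient, the form in which \<open>simsek\<close> is defined.\<close>

lemma fact_fps_exp_mult_nth:
  fixes F :: "'a::field_char_0 fps"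
  shows "fact n * fps_nth (fps_exp 1 * F) n = (\<Sum>j=0..n. of_nat (n choose j) * (fact j * fps_nth F j))"
proof -
  have "fact n * fps_nth (fps_exp 1 * F) n = (\<Sum>j=0..n. fact n * (fps_nth F j * (1 / fact (n - j))))"
    \<comment> \<open>With the exponential as second factor, the Cauchy product gives it the index
      \<open>n - j\<close> and gives \<open>F\<close> the index \<open>j\<close>.\<close>
    by (subst mult.commute) (simp add: fps_mult_nth sum_distrib_left)
  also have "\<dots> = (\<Sum>j=0..n. of_nat (n choose j) * (fact j * fps_nth F j))"
    by (rule sum.cong) (simp_all add: binomial_fact)
  finally show ?thesis .
qed

lemma simsek_gf_Suc:
  "simsek_gf \<alpha> (Suc m) lam =
     fps_const (1 / of_nat (Suc m)) *
       (fps_const lam * fps_exp 1 + fps_const (1 - of_nat m * \<alpha>)) * simsek_gf \<alpha> m lam"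
proof -
  let ?P = "deg_falling_fact (fps_const \<alpha>) (fps_const lam * fps_exp 1 + 1) m"
  have const: "fps_const (1 / fact (Suc m)) =
      fps_const (1 / of_nat (Suc m)) * fps_const (1 / fact m :: complex)"
    by simp
  have factor: "fps_const lam * fps_exp 1 + 1 - of_nat m * fps_const \<alpha> =
      fps_const lam * fps_exp 1 + fps_const (1 - of_nat m * \<alpha>)"
    by (simp add: fps_const_sub[symmetric] fps_const_mult[symmetric] fps_of_nat
        del: fps_const_sub fps_const_mult)
  have "simsek_gf \<alpha> (Suc m) lam = fps_const (1 / fact (Suc m)) *
      (?P * (fps_const lam * fps_exp 1 + 1 - of_nat m * fps_const \<alpha>))"
    by (simp only: simsek_gf_def deg_falling_fact_def prod.lessThan_Suc)
  then show ?thesis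
    unfolding const factor simsek_gf_def by (simp only: mult_ac)
qed

text \<open>Since \<open>lam * exp t + c\<close> has derivative \<open>lam * exp t\<close>, the
  product rule yields two terms with the factor \<open>exp t\<close>. Grouping them produces F + F',
  the source of the paired summands in the recurrence; the constant \<open>c\<close> contributes
  only c F'.\<close>

lemma fps_deriv_simsek_gf_Suc:
  "fps_deriv (simsek_gf \<alpha> (Suc m) lam) =
     fps_const (lam / of_nat (Suc m)) *
       (fps_exp 1 * (simsek_gf \<alpha> m lam + fps_deriv (simsek_gf \<alpha> m lam))) +
     fps_const ((1 - of_nat m * \<alpha>) / of_nat (Suc m)) * fps_deriv (simsek_gf \<alpha> m lam)"
proof -
  \<comment> \<open>Splitting off \<open>1 / of_nat (Suc m)\<close> writes both sides in the same
    constants, so that only ring laws remain.\<close>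
  have const: "fps_const (c / of_nat (Suc m)) = fps_const (1 / of_nat (Suc m)) * fps_const c"
    for c :: complex
    by simp
  show ?thesis
    unfolding simsek_gf_Suc const[of lam] const[of "1 - of_nat m * \<alpha>"]
    by (simp add: ring_distribs mult_ac add_ac
        del: fps_const_mult fps_const_add fps_const_sub of_nat_Suc)
qed

text \<open>The factor n + 1 from differentiation turns n! into (n + 1)!, so the derivative shifts
  the index by one.\<close>

lemma simsek_Suc: "simsek \<alpha> (Suc n) k lam = fact n * fps_nth (fps_deriv (simsek_gf \<alpha> k lam)) n"
  by (simp add: simsek_def algebra_simps)

lemma simsek_recurrence:
  "simsek \<alpha> (Suc n) (Suc m) lam =
     lam / of_nat (Suc m) *
       (\<Sum>j=0..n. of_nat (n choose j) * (simsek \<alpha> j m lam + simsek \<alpha> (Suc j) m lam)) +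
     (1 - of_nat m * \<alpha>) / of_nat (Suc m) * simsek \<alpha> (Suc n) m lam"
proof -
  let ?F = "simsek_gf \<alpha> m lam"
  have "simsek \<alpha> (Suc n) (Suc m) lam =
      lam / of_nat (Suc m) * (fact n * fps_nth (fps_exp 1 * (?F + fps_deriv ?F)) n) +
      (1 - of_nat m * \<alpha>) / of_nat (Suc m) * (fact n * fps_nth (fps_deriv ?F) n)"
    unfolding simsek_Suc fps_deriv_simsek_gf_Suc fps_add_nth fps_mult_left_const_nth
    by (simp only: ring_distribs mult_ac)
  \<comment> \<open>The exponential coefficient of F + F' at \<open>j\<close> splits into the
    numbers with indices \<open>j\<close> and \<open>Suc j\<close>.\<close>
  also have "fact n * fps_nth (fps_exp 1 * (?F + fps_deriv ?F)) n =
      (\<Sum>j=0..n. of_nat (n choose j) * (simsek \<alpha> j m lam + simsek \<alpha> (Suc j) m lam))"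
    unfolding fact_fps_exp_mult_nth simsek_Suc simsek_def[of \<alpha> _ m lam]
    by (simp only: fps_add_nth ring_distribs)
  also have "fact n * fps_nth (fps_deriv ?F) n = simsek \<alpha> (Suc n) m lam"
    by (simp only: simsek_Suc)
  finally show ?thesis .
qed

lemma simsek_0: "simsek \<alpha> n 0 lam = (if n = 0 then 1 else 0)"
  by (simp add: simsek_def simsek_gf_def deg_falling_fact_def)

theorem theorem2p10:
  fixes \<alpha> lam :: complex
  assumes "\<alpha> \<noteq> 0"
  shows "(\<forall>n k :: nat. k \<ge> 1 \<longrightarrow>
            simsek \<alpha> (n + 1) k lam =
              lam / of_nat k *
                (\<Sum>j=0..n. of_nat (n choose j) *
                   (simsek \<alpha> j (k - 1) lam + simsek \<alpha> (j + 1) (k - 1) lam)) +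
              (1 + \<alpha> - of_nat k * \<alpha>) / of_nat k * simsek \<alpha> (n + 1) (k - 1) lam) \<and>
         (\<forall>n :: nat. simsek \<alpha> n 0 lam = (if n = 0 then 1 else 0))"
proof (intro conjI allI impI)
  fix n k :: nat
  assume "k \<ge> 1"
  then obtain m where k: "k = Suc m"
    by (cases k) auto
  \<comment> \<open>The last factor of the falling factorial of length k subtracts (k - 1) \<alpha>,
    whence the extra \<alpha> in the stated coefficient.\<close>
  have "1 + \<alpha> - of_nat (Suc m) * \<alpha> = 1 - of_nat m * \<alpha>"
    by (simp add: algebra_simps)
  then show "simsek \<alpha> (n + 1) k lam =
      lam / of_nat k *
        (\<Sum>j=0..n. of_nat (n choose j) *
           (simsek \<alpha> j (k - 1) lam + simsek \<alpha> (j + 1) (k - 1) lam)) +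
      (1 + \<alpha> - of_nat k * \<alpha>) / of_nat k * simsek \<alpha> (n + 1) (k - 1) lam"
    unfolding k by (simp only: simsek_recurrence diff_Suc_1 Suc_eq_plus1[symmetric])
qed (rule simsek_0)

end
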